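(* Let $s(n,k)$ be the number of partial packing paths of width $n$ ending at height $k$, with $s(n,k)=0$ for $n<0$. For any positive integers $n,k$ (with $k\ne 2n+1$ in the second relation, so that the width on its left-hand side is not $0$), we have the following relations: $$s(4n-2k+2,2k+2)=s(4n-2k,2k)+4\sum_{\ell\ge0}s(4n-2(k+\ell)-2,\,2k+2\ell+2),$$ $$s(4n-2k+2,0)=2\sum_{\ell\ge0}s(4n-2(k+2\ell)-2,\,4\ell)+6\sum_{\ell\ge0}s(4n-2(k+2\ell+1)-2,\,4\ell+2).$$
   Context: Consider the hexagonal packing of the plane by circles of radius $2$ with centers $(2+4i+2j,\,2\sqrt3\,j)$, $i,j\in\mathbb Z$; the origin is the tangency point of two horizontally adjacent circles. The tangency points cut every circle into six arcs. Traversed from left to right these give six types of steps (angles measured on the circle carrying the arc): $U$ from $180^\circ$ to $120^\circ$ (displacement $(1,\sqrt3)$), $F$ from $120^\circ$ to $60^\circ$ (displacement $(2,0)$), $D$ from $60^\circ$ to $0^\circ$ (displacement $(1,-\sqrt3)$), $\overline U$ from $300^\circ$ to $360^\circ$ (displacement $(1,\sqrt3)$), $\overline F$ from $240^\circ$ to $300^\circ$ (displacement $(2,0)$), $\overline D$ from $180^\circ$ to $240^\circ$ (displacement $(1,-\sqrt3)$). A path in the packing starts at the origin, is a concatenation of such arcs of circles of the packing, each starting where the previous one ends, and stays in the quarter plane $x,y\ge 0$. Equivalently, it is a word in $\{U,F,D,\overline U,\overline F,\overline D\}$ whose first step (if any) is $U$, in which $U$ or $\overline F$ can only be followed by $F$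 or $\overline U$; $F$ or $\overline D$ only by $\overline F$ or $D$; $\overline U$ or $D$ only by $U$ or $\overline D$; and which never goes below ordinate $0$. A packing path is such a path ending on the $x$-axis; a partial packing path is any prefix of a packing path. The empty path is allowed. The width of a path is the abscissa of its endpoint (so $U,D,\overline U,\overline D$ contribute $1$ and $F,\overline F$ contribute $2$). The (final) height of a path is the integer $k$ such that its endpoint has ordinate $k\sqrt3$. *)

theory Defs
  imports Complex_Main "HOL-Library.Sublist"
begin

(* Ub, Fb, Db are the barred steps. *)
datatype arc_step = U | F | D | Ub | Fb | Db

fun followers :: "arc_step \<Rightarrow> arc_step set" where
  "followers U = {F, Ub}"
| "followers Fb = {F, Ub}"
| "followers F = {Fb, D}"
| "followers Db = {Fb, D}"
| "followers Ub = {U, Db}"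
| "followers D = {U, Db}"

fun step_width :: "arc_step \<Rightarrow> int" where
  "step_width F = 2"
| "step_width Fb = 2"
| "step_width U = 1"
| "step_width D = 1"
| "step_width Ub = 1"
| "step_width Db = 1"

(* Vertical displacement in units of sqrt 3. *)
fun step_rise :: "arc_step \<Rightarrow> int" where
  "step_rise U = 1"
| "step_rise Ub = 1"
| "step_rise F = 0"
| "step_rise Fb = 0"
| "step_rise D = - 1"
| "step_rise Db = - 1"

definition width :: "arc_step list \<Rightarrow> int" where
  "width w = (\<Sum>a\<leftarrow>w. step_width a)"

definition height :: "arc_step list \<Rightarrow> int" where
  "height w = (\<Sum>a\<leftarrow>w. step_rise a)"

(* The condition of never going below ordinate 0 is imposed at the endpoints of the arcs only.
   This suffices: among the six arcs only Fb goes below both of its endpoints. It starts and ends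
   at an odd height h \<ge> 1 (see odd_height_Fb) and goes down to the ordinate
   (h + 1) * sqrt 3 - 2 > 0. *)
definition path :: "arc_step list \<Rightarrow> bool" where
  "path w \<longleftrightarrow>
     (w \<noteq> [] \<longrightarrow> hd w = U) \<and>
     successively (\<lambda>a b. b \<in> followers a) w \<and>
     (\<forall>v. prefix v w \<longrightarrow> height v \<ge> 0)"

definition packing_path :: "arc_step list \<Rightarrow> bool" where
  "packing_path w \<longleftrightarrow> path w \<and> height w = 0"

definition partial_packing_path :: "arc_step list \<Rightarrow> bool" where
  "partial_packing_path v \<longleftrightarrow> (\<exists>w. packing_path w \<and> prefix v w)"

definition s :: "int \<Rightarrow> int \<Rightarrow> nat" where
  "s n k = card {w. partial_packing_path w \<and> width w = n \<and> height w = k}"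


lemma path_prefix:
  assumes "path w" "prefix v w"
  shows "path v"
  using assms
  by (auto simp: path_def prefix_def successively_append_iff)

lemma odd_height_iff_last:
  assumes "path w" "w \<noteq> []"
  shows "odd (height w) \<longleftrightarrow> last w \<in> {U, F, Fb, Db}"
  using assms
proof (induction w rule: rev_induct)
  case (snoc a v)
  show ?case
  proof (cases "v = []")
    case True
    with snoc.prems show ?thesis
      by (simp add: path_def height_def)
  next
    case False
    moreover from False snoc.prems have "a \<in> followers (last v)"
      by (auto simp: path_def successively_append_iff)
    moreover have "path v"
      using snoc.prems by (auto intro: path_prefix)
    ultimately show ?thesis
      using snoc.IH by (cases "last v") (auto simp: height_def)
  qed
qed simp

lemma odd_height_Fb:
  assumes "path (w @ [Fb])"
  shows "odd (height w)"
  using odd_height_iff_last[OF assms] by (simp add: height_def)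

lemma length_le_width: "int (length w) \<le> width w"
proof (induction w)
  case (Cons a w)
  then show ?case by (cases a) (auto simp: width_def)
qed (simp add: width_def)

(* Hence card in the definition of s does count. *)
lemma finite_width: "finite {w. width w = n}"
proof (rule finite_subset)
  have "UNIV = {U, F, D, Ub, Fb, Db}"
    using arc_step.exhaust by blast
  then have "finite (UNIV :: arc_step set)"
    by (metis finite.emptyI finite_insert)
  then show "finite {w. set w \<subseteq> (UNIV :: arc_step set) \<and> length w \<le> nat n}"
    by (rule finite_lists_length_le)
  show "{w. width w = n} \<subseteq> {w. set w \<subseteq> UNIV \<and> length w \<le> nat n}"
    using length_le_width by (auto simp: le_nat_iff) (metis nat_int nat_mono)
qed

(* Hence the series in the relations for s have finitely many nonzero terms. *)
lemma s_eq_0_if_neg: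
  assumes "n < 0"
  shows "s n k = 0"
proof -
  have "width w \<noteq> n" for w
    using length_le_width[of w] assms by linarith
  then show ?thesis by (simp add: s_def)
qed

end

theory Submission
  imports Defs
begin

text \<open>
  The steps allowed next divide the paths into three classes, and removing the last step relates
  their numbers. Even heights are reached exactly by the paths that are empty or may go on with
  \<open>U\<close> or \<open>Db\<close>, so eliminating the other two classes leaves, for \<open>t N K = s (2 N) (2 K)\<close>, the
  recurrence \<open>t N K = t (N-1) (K-1) + t (N-1) (K+1) + 3 t (N-2) K\<close> if \<open>K \<ge> 1\<close>, and
  \<open>t N 0 = t (N-1) 1 + 2 t (N-2) 0\<close> with corrections at \<open>N = 0\<close> and \<open>N = 2\<close>.

  The first relation telescopes: its difference with the same relation for \<open>(N-1, K+1)\<close> is the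
  recurrence. For the second one, the recurrence summed along an antidiagonal with alternating
  signs gives \<open>t N 0 = 2 (t (N-1) 1 - t (N-2) 2 + t (N-3) 3 - \<dots>)\<close> if \<open>N \<noteq> 0\<close>. Adding this to
  the first relation turns the uniform coefficient 4 into 6 at odd and 2 at even half-heights.
\<close>

subsection \<open>Removing the last step\<close>

text \<open>The value at \<open>[]\<close> places the empty path in the class of
  \<open>{U, Db}\<close>. There \<open>Db\<close> would lead below the axis, so the height condition
  alone forces the first step to be \<open>U\<close>.\<close>

definition next_steps :: "arc_step list \<Rightarrow> arc_step set" where
  "next_steps w = (if w = [] then {U, Db} else followers (last w))"

lemma next_steps_snoc [simp]: "next_steps (w @ [a]) = followers a"
  by (simp add: next_steps_def)

lemma next_steps_cases:
  obtains "next_steps w = {U, Db}" | "next_steps w = {F, Ub}" | "next_steps w = {Fb, D}"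
proof -
  have "followers a = {U, Db} \<or> followers a = {F, Ub} \<or> followers a = {Fb, D}" for a
    by (cases a) simp_all
  then have "next_steps w = {U, Db} \<or> next_steps w = {F, Ub} \<or> next_steps w = {Fb, D}"
    unfolding next_steps_def by presburger
  then show thesis
    by (elim disjE) (fact that)+
qed

lemma width_snoc [simp]: "width (w @ [a]) = width w + step_width a"
  by (simp add: width_def)

lemma height_snoc [simp]: "height (w @ [a]) = height w + step_rise a"
  by (simp add: height_def)

lemma path_height_nonneg: "path w \<Longrightarrow> height w \<ge> 0"
  by (simp add: path_def)

lemma path_Nil [simp]: "path []"
  by (simp add: path_def height_def)

lemma path_snoc:
  "path (w @ [a]) \<longleftrightarrow> path w \<and> a \<in> next_steps w \<and> height w + step_rise a \<ge> 0"
proof (cases "w = []")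
  case True
  then show ?thesis
    by (cases a) (auto simp: path_def next_steps_def height_def prefix_Cons)
next
  case False
  then show ?thesis
    by (auto simp: path_def next_steps_def successively_append_iff)
qed

text \<open>From positive height every class can descend one level: directly by \<open>Db\<close> or
  \<open>D\<close>, or by \<open>F\<close> followed by \<open>D\<close>. Induction on the height
  brings the path to the axis.\<close>

lemma path_extends_to_packing_path:
  assumes "path w"
  shows "\<exists>u. packing_path (w @ u)"
  using assms
proof (induction "nat (height w)" arbitrary: w)
  case 0
  then have "height w = 0"
    using path_height_nonneg[of w] by simp
  with 0 have "packing_path (w @ [])"
    by (simp add: packing_path_def)
  then show ?case ..
next
  case (Suc m)
  have h: "height w = int (Suc m)"
    using Suc.hyps(2) by linarith
  have extend: "\<exists>u. packing_path (v @ u)" if "path v" "height v = int m" for v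
    using Suc.hyps(1)[of v] that by simp
  show ?case
  proof (cases w rule: next_steps_cases)
    case 1
    then have "\<exists>u. packing_path ((w @ [Db]) @ u)"
      using Suc.prems h by (intro extend) (auto simp: path_snoc)
    then show ?thesis by auto
  next
    case 2
    then have "path (w @ [F])"
      using Suc.prems h by (auto simp: path_snoc)
    then have "\<exists>u. packing_path (((w @ [F]) @ [D]) @ u)"
      using h by (intro extend) (auto simp: path_snoc simp del: append_assoc)
    then show ?thesis by auto
  next
    case 3
    then have "\<exists>u. packing_path ((w @ [D]) @ u)"
      using Suc.prems h by (intro extend) (auto simp: path_snoc)
    then show ?thesis by auto
  qed
qed

lemma partial_packing_path_iff_path: "partial_packing_path w \<longleftrightarrow> path w"
  unfolding partial_packing_path_def packing_path_def
  using path_extends_to_packing_path[of w] path_prefix packing_path_def prefixI by blast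

section \<open>Counting paths by their possible next steps\<close>

definition num_paths :: "arc_step set \<Rightarrow> int \<Rightarrow> int \<Rightarrow> nat" where
  "num_paths S n h = card {w. path w \<and> next_steps w = S \<and> width w = n \<and> height w = h}"

lemma finite_paths [simp]:
  "finite {w. path w \<and> next_steps w = S \<and> width w = n \<and> height w = h}"
  by (rule finite_subset[OF _ finite_width[of n]]) auto

lemma next_steps_eq_iff:
  "U \<in> next_steps w \<longleftrightarrow> next_steps w = {U, Db}"
  "Db \<in> next_steps w \<longleftrightarrow> next_steps w = {U, Db}"
  "F \<in> next_steps w \<longleftrightarrow> next_steps w = {F, Ub}"
  "Ub \<in> next_steps w \<longleftrightarrow> next_steps w = {F, Ub}"
  "Fb \<in> next_steps w \<longleftrightarrow> next_steps w = {Fb, D}"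
  "D \<in> next_steps w \<longleftrightarrow> next_steps w = {Fb, D}"
  by (cases w rule: next_steps_cases; simp add: doubleton_eq_iff)+

text \<open>The class \<open>S\<close> fixes the last step up to the two choices \<open>a\<close>
  and \<open>b\<close>, and each choice fixes the class of what remains. The \<open>of_bool\<close>
  term counts the empty path, which has no last step.\<close>

lemma num_paths_snoc:
  assumes "h \<ge> 0" and "a \<noteq> b" and pre: "\<And>x. followers x = S \<longleftrightarrow> x = a \<or> x = b"
    and A: "\<And>w. a \<in> next_steps w \<longleftrightarrow> next_steps w = A"
    and B: "\<And>w. b \<in> next_steps w \<longleftrightarrow> next_steps w = B"
  shows "num_paths S n h =
    num_paths A (n - step_width a) (h - step_rise a)
    + num_paths B (n - step_width b) (h - step_rise b)
    + of_bool (S = {U, Db} \<and> n = 0 \<and> h = 0)"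
proof -
  define P where
    "P S n h = {w. path w \<and> next_steps w = S \<and> width w = n \<and> height w = h}" for S n h
  define Pa where "Pa = (\<lambda>w. w @ [a]) ` P A (n - step_width a) (h - step_rise a)"
  define Pb where "Pb = (\<lambda>w. w @ [b]) ` P B (n - step_width b) (h - step_rise b)"
  define Pe where
    "Pe = (if S = {U, Db} \<and> n = 0 \<and> h = 0 then {[]} else {} :: arc_step list set)"
  have "w \<in> P S n h \<longleftrightarrow> w \<in> Pa \<union> Pb \<union> Pe" for w
  proof (cases w rule: rev_cases)
    case Nil
    have "[] \<in> P S n h \<longleftrightarrow> S = {U, Db} \<and> n = 0 \<and> h = 0"
      by (simp add: P_def next_steps_def width_def height_def
          eq_commute[of _ S] eq_commute[of 0 n] eq_commute[of 0 h])
    with Nil show ?thesis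
      by (simp add: Pa_def Pb_def Pe_def image_iff)
  next
    case (snoc v x)
    have "w \<in> P S n h \<longleftrightarrow>
        path v \<and> x \<in> next_steps v \<and> (x = a \<or> x = b)
        \<and> width v = n - step_width x \<and> height v = h - step_rise x"
      \<comment> \<open>The final height is \<open>h\<close>, so \<open>h \<ge> 0\<close> settles
        the height condition of \<open>path_snoc\<close>.\<close>
      using \<open>h \<ge> 0\<close> by (auto simp: P_def snoc path_snoc pre)
    moreover have "w \<in> Pa \<longleftrightarrow> x = a \<and> v \<in> P A (n - step_width a) (h - step_rise a)"
      "w \<in> Pb \<longleftrightarrow> x = b \<and> v \<in> P B (n - step_width b) (h - step_rise b)" "w \<notin> Pe"
      by (auto simp: snoc Pa_def Pb_def Pe_def)
    moreover have "v \<in> P A l i \<longleftrightarrow> path v \<and> a \<in> next_steps v \<and> width v = l \<and> height v = i"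
      "v \<in> P B l i \<longleftrightarrow> path v \<and> b \<in> next_steps v \<and> width v = l \<and> height v = i" for l i
      by (simp_all only: P_def mem_Collect_eq A B)
    ultimately show ?thesis
      by (simp only: Un_iff) blast
  qed
  then have "P S n h = Pa \<union> Pb \<union> Pe"
    by blast
  moreover have "finite Pa" "finite Pb" "finite Pe"
    by (auto simp: P_def Pa_def Pb_def Pe_def)
  moreover have "Pa \<inter> Pb = {}" "(Pa \<union> Pb) \<inter> Pe = {}"
    using \<open>a \<noteq> b\<close> by (auto simp: Pa_def Pb_def Pe_def)
  ultimately have "card (P S n h) = card Pa + card Pb + card Pe"
    by (simp add: card_Un_disjoint)
  moreover have "card Pa = num_paths A (n - step_width a) (h - step_rise a)"
    "card Pb = num_paths B (n - step_width b) (h - step_rise b)"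
    by (simp_all add: num_paths_def P_def Pa_def Pb_def card_image inj_on_def)
  moreover have "card Pe = of_bool (S = {U, Db} \<and> n = 0 \<and> h = 0)"
    by (simp add: Pe_def)
  ultimately show ?thesis
    by (simp add: num_paths_def P_def)
qed

lemma num_paths_rec:
  assumes "h \<ge> 0"
  shows "num_paths {F, Ub} n h = num_paths {U, Db} (n - 1) (h - 1) + num_paths {Fb, D} (n - 2) h"
    and "num_paths {Fb, D} n h = num_paths {F, Ub} (n - 2) h + num_paths {U, Db} (n - 1) (h + 1)"
    and "num_paths {U, Db} n h =
      num_paths {F, Ub} (n - 1) (h - 1) + num_paths {Fb, D} (n - 1) (h + 1) + of_bool (n = 0 \<and> h = 0)"
proof -
  have pre: "followers x = {F, Ub} \<longleftrightarrow> x = U \<or> x = Fb"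
    "followers x = {Fb, D} \<longleftrightarrow> x = F \<or> x = Db"
    "followers x = {U, Db} \<longleftrightarrow> x = Ub \<or> x = D" for x
    by (cases x; simp add: doubleton_eq_iff)+
  note rec = num_paths_snoc[OF assms _ pre(1) next_steps_eq_iff(1) next_steps_eq_iff(5), of n]
    num_paths_snoc[OF assms _ pre(2) next_steps_eq_iff(3) next_steps_eq_iff(2), of n]
    num_paths_snoc[OF assms _ pre(3) next_steps_eq_iff(4) next_steps_eq_iff(6), of n]
  show "num_paths {F, Ub} n h = num_paths {U, Db} (n - 1) (h - 1) + num_paths {Fb, D} (n - 2) h"
    using rec(1) by (simp add: doubleton_eq_iff)
  show "num_paths {Fb, D} n h = num_paths {F, Ub} (n - 2) h + num_paths {U, Db} (n - 1) (h + 1)"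
    using rec(2) by (simp add: doubleton_eq_iff)
  show "num_paths {U, Db} n h =
      num_paths {F, Ub} (n - 1) (h - 1) + num_paths {Fb, D} (n - 1) (h + 1) + of_bool (n = 0 \<and> h = 0)"
    using rec(3) by simp
qed

lemma num_paths_neg_height: "h < 0 \<Longrightarrow> num_paths S n h = 0"
  by (auto simp: num_paths_def dest: path_height_nonneg)

section \<open>Recurrences at even heights\<close>

lemma even_height_iff_next_steps:
  assumes "path w"
  shows "even (height w) \<longleftrightarrow> next_steps w = {U, Db}"
proof (cases "w = []")
  case True
  then show ?thesis by (simp add: height_def next_steps_def)
next
  case False
  then show ?thesis
    using odd_height_iff_last[OF assms] by (cases "last w") (auto simp: next_steps_def)
qed

lemma s_even_height: "even h \<Longrightarrow> s n h = num_paths {U, Db} n h"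
  unfolding s_def num_paths_def partial_packing_path_iff_path
  by (rule arg_cong[where f = card]) (auto simp: even_height_iff_next_steps)

text \<open>Unfolding the odd-height classes twice yields two copies of the count at
  \<open>(n - 4, h)\<close> and two leftovers of width \<open>n - 5\<close>, whose sum is a third
  copy.\<close>

lemma s_rec:
  assumes "even h" "h > 0"
  shows "s n h = s (n - 2) (h - 2) + s (n - 2) (h + 2) + 3 * s (n - 4) h"
proof -
  have "num_paths {F, Ub} (n - 1) (h - 1) =
      num_paths {U, Db} (n - 2) (h - 2) + num_paths {Fb, D} (n - 3) (h - 1)"
    using num_paths_rec(1)[of "h - 1" "n - 1"] assms by simp
  moreover have "num_paths {Fb, D} (n - 3) (h - 1) =
      num_paths {F, Ub} (n - 5) (h - 1) + num_paths {U, Db} (n - 4) h"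
    using num_paths_rec(2)[of "h - 1" "n - 3"] assms by simp
  moreover have "num_paths {Fb, D} (n - 1) (h + 1) =
      num_paths {F, Ub} (n - 3) (h + 1) + num_paths {U, Db} (n - 2) (h + 2)"
    using num_paths_rec(2)[of "h + 1" "n - 1"] assms by (simp add: add.commute[of 2 h])
  moreover have "num_paths {F, Ub} (n - 3) (h + 1) =
      num_paths {U, Db} (n - 4) h + num_paths {Fb, D} (n - 5) (h + 1)"
    using num_paths_rec(1)[of "h + 1" "n - 3"] assms by simp
  moreover have "num_paths {U, Db} m h =
      num_paths {F, Ub} (m - 1) (h - 1) + num_paths {Fb, D} (m - 1) (h + 1)" for m
    using num_paths_rec(3)[of h m] assms by simp
  \<comment> \<open>The instance at \<open>n\<close> starts the unfolding; the one at
    \<open>n - 4\<close>, read backwards, absorbs the leftovers.\<close>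
  from this[of n] this[of "n - 4"] have "num_paths {U, Db} n h =
      num_paths {F, Ub} (n - 1) (h - 1) + num_paths {Fb, D} (n - 1) (h + 1)"
    and "num_paths {U, Db} (n - 4) h =
      num_paths {F, Ub} (n - 5) (h - 1) + num_paths {Fb, D} (n - 5) (h + 1)"
    by simp_all
  moreover have "s m h = num_paths {U, Db} m h" "s m (h - 2) = num_paths {U, Db} m (h - 2)"
    "s m (h + 2) = num_paths {U, Db} m (h + 2)" for m
    using assms by (simp_all add: s_even_height)
  ultimately show ?thesis
    by presburger
qed

text \<open>On the axis the branch from height \<open>-1\<close> is absent, so one copy fewer
  arises. The leftover of width \<open>n - 5\<close> is the count at \<open>n - 4\<close> without
  the empty path; this correction at \<open>n = 4\<close> stands on the left to avoid subtraction of
  naturals.\<close>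

lemma s_rec_0: "s n 0 + of_bool (n = 4) = s (n - 2) 2 + 2 * s (n - 4) 0 + of_bool (n = 0)"
proof -
  have "num_paths {U, Db} n 0 = num_paths {Fb, D} (n - 1) 1 + of_bool (n = 0)"
    using num_paths_rec(3)[of 0 n] by (simp add: num_paths_neg_height)
  moreover have "num_paths {Fb, D} (n - 1) 1 =
      num_paths {F, Ub} (n - 3) 1 + num_paths {U, Db} (n - 2) 2"
    using num_paths_rec(2)[of 1 "n - 1"] by simp
  moreover have "num_paths {F, Ub} (n - 3) 1 =
      num_paths {U, Db} (n - 4) 0 + num_paths {Fb, D} (n - 5) 1"
    using num_paths_rec(1)[of 1 "n - 3"] by simp
  moreover have "num_paths {U, Db} (n - 4) 0 = num_paths {Fb, D} (n - 5) 1 + of_bool (n = 4)"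
    using num_paths_rec(3)[of 0 "n - 4"] by (simp add: num_paths_neg_height)
  ultimately show ?thesis
    by (simp add: s_even_height)
qed

subsection \<open>Summation along antidiagonals\<close>

text \<open>Integer values permit the alternating sums and differences below.\<close>

definition t :: "int \<Rightarrow> nat \<Rightarrow> int" where
  "t N K = int (s (2 * N) (2 * int K))"

lemma t_neg [simp]: "N < 0 \<Longrightarrow> t N K = 0"
  by (simp add: t_def s_eq_0_if_neg)

lemma t_Suc: "t N (Suc K) = t (N - 1) K + t (N - 1) (Suc (Suc K)) + 3 * t (N - 2) (Suc K)"
  using s_rec[of "2 * int (Suc K)" "2 * N"]
  by (simp add: t_def right_diff_distrib distrib_left add.commute)

lemma t_0: "t N 0 = t (N - 1) 1 + 2 * t (N - 2) 0 + of_bool (N = 0) - of_bool (N = 2)"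
  using arg_cong[OF s_rec_0[of "2 * N"], of int]
  by (auto simp: t_def right_diff_distrib)

lemma t_nonpos_Suc: "N \<le> 0 \<Longrightarrow> t N (Suc K) = 0"
  using t_Suc[of N K] by simp

text \<open>The bound \<open>m\<close> only truncates the series: beyond it the widths are
  negative.\<close>

lemma t_telescope:
  assumes "N \<le> int m"
  shows "t (N + 1) (Suc K) = t N K + 4 * (\<Sum>l<m. t (N - 1 - int l) (Suc K + l))"
  using assms
proof (induction m arbitrary: N K)
  case 0
  then show ?case
    using t_Suc[of "N + 1" K] by (simp add: t_nonpos_Suc)
next
  case (Suc m)
  \<comment> \<open>The relation for \<open>(N - 1, K + 1)\<close> expands the upper neighbour in
    \<open>t_Suc\<close>; its leading term joins the coefficient 3 to give 4.\<close>
  have "t N (Suc (Suc K)) = t (N - 1) (Suc K) + 4 * (\<Sum>l<m. t (N - 2 - int l) (Suc (Suc K) + l))"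
    using Suc.IH[of "N - 1" "Suc K"] Suc.prems by (simp add: algebra_simps)
  moreover have "(\<Sum>l<Suc m. t (N - 1 - int l) (Suc K + l)) =
      t (N - 1) (Suc K) + (\<Sum>l<m. t (N - 2 - int l) (Suc (Suc K) + l))"
    unfolding sum.lessThan_Suc_shift by (simp add: algebra_simps)
  ultimately show ?case
    using t_Suc[of "N + 1" K] by simp
qed

lemma t_alternating:
  assumes "M \<le> int m"
  shows "2 * (\<Sum>l<m. (- 1) ^ l * t (M - 1 - int l) (Suc l)) = t M 0 - of_bool (M = 0)"
  using assms
\<comment> \<open>The measure must still drop from \<open>M = 0\<close> to \<open>M - 2\<close>,
  hence the shift by 1.\<close>
proof (induction "nat (M + 1)" arbitrary: M rule: less_induct)
  case less
  define X where "X M = (\<Sum>l<m. (- 1) ^ l * t (M - 1 - int l) (Suc l))" for M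
  show ?case
  proof (cases "M < 0")
    case True
    then show ?thesis by simp
  next
    case False
    have IH: "2 * X (M - 2) = t (M - 2) 0 - of_bool (M = 2)"
      using less.hyps[of "M - 2"] less.prems False by (simp add: X_def)
    \<comment> \<open>The lower neighbours form the antidiagonal of \<open>M - 2\<close> with an
      extra first term and opposite signs. The added summand at \<open>l = m\<close> has negative
      width.\<close>
    have shift_down: "(\<Sum>l<m. (- 1) ^ l * t (M - 2 - int l) l) = t (M - 2) 0 - X (M - 2)"
    proof -
      have "(\<Sum>l<m. (- 1) ^ l * t (M - 2 - int l) l) =
          (\<Sum>l<Suc m. (- 1) ^ l * t (M - 2 - int l) l)"
        using less.prems by simp
      also have "\<dots> = t (M - 2) 0 - X (M - 2)"
        unfolding sum.lessThan_Suc_shift by (simp add: X_def sum_negf algebra_simps)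
      finally show ?thesis .
    qed
    \<comment> \<open>The upper neighbours form the antidiagonal of \<open>M\<close> itself without
      its first term, so \<open>X M\<close> reappears with a minus sign; this produces the factor
      2.\<close>
    have shift_up: "(\<Sum>l<m. (- 1) ^ l * t (M - 2 - int l) (Suc (Suc l))) = t (M - 1) 1 - X M"
    proof -
      have "X M = (\<Sum>l<Suc m. (- 1) ^ l * t (M - 1 - int l) (Suc l))"
        using less.prems by (simp add: X_def)
      also have "\<dots> = t (M - 1) 1 - (\<Sum>l<m. (- 1) ^ l * t (M - 2 - int l) (Suc (Suc l)))"
        unfolding sum.lessThan_Suc_shift by (simp add: sum_negf algebra_simps)
      finally show ?thesis by simp
    qed
    have "t (M - 1 - int l) (Suc l) =
        t (M - 2 - int l) l + t (M - 2 - int l) (Suc (Suc l)) + 3 * t (M - 2 - 1 - int l) (Suc l)" for l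
      using t_Suc[of "M - 1 - int l" l] by (simp add: algebra_simps)
    then have "X M = (\<Sum>l<m. (- 1) ^ l * t (M - 2 - int l) l)
        + (\<Sum>l<m. (- 1) ^ l * t (M - 2 - int l) (Suc (Suc l))) + 3 * X (M - 2)"
      by (simp add: X_def sum.distrib sum_distrib_left distrib_left mult.left_commute)
    then have "2 * X M = t (M - 2) 0 + t (M - 1) 1 + 2 * X (M - 2)"
      unfolding shift_down shift_up by simp
    then show ?thesis
      using IH t_0[of M] by (simp add: X_def)
  qed
qed

lemma sum_lessThan_double:
  fixes f :: "nat \<Rightarrow> 'a::comm_monoid_add"
  shows "(\<Sum>l<2 * p. f l) = (\<Sum>j<p. f (2 * j)) + (\<Sum>j<p. f (Suc (2 * j)))"
  by (induction p) (simp_all add: ac_simps)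

text \<open>By \<open>t_0\<close> and \<open>t_telescope\<close> the left side contains
  \<open>t (N - 1) 0\<close> three times. Replacing just one copy by the alternating sum turns the
  coefficients 4 into 6 and 2 and cancels the correction at \<open>N = 1\<close>;
  \<open>N \<noteq> - 1\<close> rules out the empty path.\<close>

lemma t_axis:
  assumes "N \<noteq> - 1" "N \<le> int p"
  shows "t (N + 1) 0 = 2 * (\<Sum>l<Suc p. t (N - 1 - 2 * int l) (2 * l))
    + 6 * (\<Sum>l<p. t (N - 2 - 2 * int l) (Suc (2 * l)))"
proof -
  define f where "f l = t (N - 2 - int l) (Suc l)" for l
  have odd_part: "f (2 * l) = t (N - 2 - 2 * int l) (Suc (2 * l))" for l
    by (simp add: f_def)
  have "(\<Sum>l<Suc p. t (N - 1 - 2 * int l) (2 * l)) = t (N - 1) 0 + (\<Sum>l<p. f (Suc (2 * l)))"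
    unfolding sum.lessThan_Suc_shift by (simp add: f_def algebra_simps)
  moreover have "t N 1 = t (N - 1) 0 + 4 * (\<Sum>l<2 * p. f l)"
    using t_telescope[of "N - 1" "2 * p" 0] assms by (simp add: f_def algebra_simps)
  moreover have "t (N - 1) 0 = 2 * (\<Sum>l<2 * p. (- 1) ^ l * f l) + of_bool (N = 1)"
    using t_alternating[of "N - 1" "2 * p"] assms by (simp add: f_def algebra_simps)
  ultimately show ?thesis
    using t_0[of "N + 1"] assms
    by (simp add: sum_lessThan_double odd_part[symmetric] sum_negf)
qed

theorem corollary5:
  fixes n k :: int
  assumes "n > 0" and "k > 0"
  shows "s (4*n - 2*k + 2) (2*k + 2)
           = s (4*n - 2*k) (2*k)
             + 4 * (\<Sum>l. s (4*n - 2*(k + int l) - 2) (2*k + 2 * int l + 2))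
         \<and> (k \<noteq> 2*n + 1 \<longrightarrow>
            s (4*n - 2*k + 2) 0
              = 2 * (\<Sum>l. s (4*n - 2*(k + 2 * int l) - 2) (4 * int l))
                + 6 * (\<Sum>l. s (4*n - 2*(k + 2 * int l + 1) - 2) (4 * int l + 2)))"
proof -
  define N where "N = 2 * n - k"
  define K where "K = nat k"
  \<comment> \<open>One bound for all three series: \<open>k > 0\<close> gives
    \<open>N < 2 * n\<close>, so the omitted terms have negative width.\<close>
  define m where "m = nat (2 * n)"
  have N: "N \<le> int m" and k: "k = int K"
    using assms by (auto simp: N_def K_def m_def)
  have sum1: "int (\<Sum>l. s (4*n - 2*(k + int l) - 2) (2*k + 2 * int l + 2)) =
      (\<Sum>l<m. t (N - 1 - int l) (Suc K + l))"
  proof (subst suminf_finite[of "{..<m}"])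
    show "s (4*n - 2*(k + int l) - 2) (2*k + 2 * int l + 2) = 0" if "l \<notin> {..<m}" for l
      using that N by (intro s_eq_0_if_neg) (simp add: N_def)
  qed (auto simp: t_def N_def k algebra_simps intro!: sum.cong)
  have sum2: "int (\<Sum>l. s (4*n - 2*(k + 2 * int l) - 2) (4 * int l)) =
      (\<Sum>l<Suc m. t (N - 1 - 2 * int l) (2 * l))"
  proof (subst suminf_finite[of "{..<Suc m}"])
    show "s (4*n - 2*(k + 2 * int l) - 2) (4 * int l) = 0" if "l \<notin> {..<Suc m}" for l
      using that N by (intro s_eq_0_if_neg) (simp add: N_def)
  qed (auto simp del: sum.lessThan_Suc simp: t_def N_def algebra_simps intro!: sum.cong)
  have sum3: "int (\<Sum>l. s (4*n - 2*(k + 2 * int l + 1) - 2) (4 * int l + 2)) =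
      (\<Sum>l<m. t (N - 2 - 2 * int l) (Suc (2 * l)))"
  proof (subst suminf_finite[of "{..<m}"])
    show "s (4*n - 2*(k + 2 * int l + 1) - 2) (4 * int l + 2) = 0" if "l \<notin> {..<m}" for l
      using that N by (intro s_eq_0_if_neg) (simp add: N_def)
  qed (auto simp: t_def N_def algebra_simps intro!: sum.cong)
  have lhs: "int (s (4*n - 2*k + 2) (2*k + 2)) = t (N + 1) (Suc K)"
    "int (s (4*n - 2*k) (2*k)) = t N K" "int (s (4*n - 2*k + 2) 0) = t (N + 1) 0"
    by (simp_all add: t_def N_def k algebra_simps)
  have "int (s (4*n - 2*k + 2) (2*k + 2)) = int (s (4*n - 2*k) (2*k))
      + 4 * int (\<Sum>l. s (4*n - 2*(k + int l) - 2) (2*k + 2 * int l + 2))"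
    unfolding lhs sum1 by (rule t_telescope[OF N])
  moreover have "int (s (4*n - 2*k + 2) 0)
      = 2 * int (\<Sum>l. s (4*n - 2*(k + 2 * int l) - 2) (4 * int l))
        + 6 * int (\<Sum>l. s (4*n - 2*(k + 2 * int l + 1) - 2) (4 * int l + 2))" if "k \<noteq> 2*n + 1"
    unfolding lhs sum2 sum3 using that by (intro t_axis N) (simp add: N_def)
  ultimately show ?thesis
    by linarith
qed

end
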